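(* For all sufficiently large integers $n$, $$t(2n)-t(2n-1) \geq 0.0356\, n^2 .$$
   Context: For a positive integer $n$ let $[n]=\{1,\dots,n\}$. The $n\times n$ torus $\mathbb{T}_n$ is the hypergraph with vertex set $[n]\times[n]$ whose hyperedges are: the rows $\{i\}\times[n]$ for $i\in[n]$; the columns $[n]\times\{j\}$ for $j\in[n]$; the $\mathbb{Z}_n$-diagonals $\{(i,j)\in[n]\times[n] : i-j\equiv k \pmod n\}$ for $k\in\mathbb{Z}_n$; and the $\mathbb{Z}_n$-skew-diagonals $\{(i,j)\in[n]\times[n] : i+j\equiv k \pmod n\}$ for $k\in\mathbb{Z}_n$. A peaceful battle on $\mathbb{T}_n$ is a pair $(B,W)$ of disjoint subsets of $[n]\times[n]$ such that $e\cap B=\emptyset$ or $e\cap W=\emptyset$ for every hyperedge $e$ of $\mathbb{T}_n$. The number $t(n)$ is the maximum integer $m$ such that there is a peaceful battle $(B,W)$ on $\mathbb{T}_n$ with $|B|=|W|=m$. *)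

theory Defs
  imports Complex_Main "HOL-Number_Theory.Cong"
begin

definition torus_vertices :: "nat \<Rightarrow> (nat \<times> nat) set" where
  "torus_vertices n = {1..n} \<times> {1..n}"

definition torus_row :: "nat \<Rightarrow> nat \<Rightarrow> (nat \<times> nat) set" where
  "torus_row n i = {i} \<times> {1..n}"

definition torus_column :: "nat \<Rightarrow> nat \<Rightarrow> (nat \<times> nat) set" where
  "torus_column n j = {1..n} \<times> {j}"

definition torus_diagonal :: "nat \<Rightarrow> int \<Rightarrow> (nat \<times> nat) set" where
  "torus_diagonal n k = {(i, j) \<in> torus_vertices n. [int i - int j = k] (mod int n)}"

definition torus_skew_diagonal :: "nat \<Rightarrow> int \<Rightarrow> (nat \<times> nat) set" where
  "torus_skew_diagonal n k = {(i, j) \<in> torus_vertices n. [int i + int j = k] (mod int n)}"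

(* Elements of Z_n are represented by the integers 0, ..., n - 1. *)
definition torus_hyperedges :: "nat \<Rightarrow> (nat \<times> nat) set set" where
  "torus_hyperedges n =
     torus_row n ` {1..n} \<union> torus_column n ` {1..n} \<union>
     torus_diagonal n ` {0..<int n} \<union> torus_skew_diagonal n ` {0..<int n}"

definition peaceful_battle :: "nat \<Rightarrow> (nat \<times> nat) set \<Rightarrow> (nat \<times> nat) set \<Rightarrow> bool" where
  "peaceful_battle n B W \<longleftrightarrow>
     B \<subseteq> torus_vertices n \<and> W \<subseteq> torus_vertices n \<and> B \<inter> W = {} \<and>
     (\<forall>e \<in> torus_hyperedges n. e \<inter> B = {} \<or> e \<inter> W = {})"

definition battle_sizes :: "nat \<Rightarrow> nat set" where
  "battle_sizes n = {m. \<exists>B W. peaceful_battle n B W \<and> card B = m \<and> card W = m}"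

lemma zero_in_battle_sizes: "0 \<in> battle_sizes n"
proof -
  have "peaceful_battle n {} {}"
    by (simp add: peaceful_battle_def)
  then show ?thesis
    unfolding battle_sizes_def by (metis (mono_tags, lifting) card.empty mem_Collect_eq)
qed

lemma finite_battle_sizes: "finite (battle_sizes n)"
proof (rule finite_subset)
  have "finite (torus_vertices n)"
    by (simp add: torus_vertices_def)
  then show "battle_sizes n \<subseteq> {..card (torus_vertices n)}"
    unfolding battle_sizes_def peaceful_battle_def by (auto intro: card_mono)
qed simp

(* The two lemmas above show that this maximum is attained for every n. *)
definition torus_t :: "nat \<Rightarrow> nat" where
  "torus_t n = Max (battle_sizes n)"

end

theory Submission
  imports Defs "HOL-Analysis.Convex"
begin

text \<open>
  The gap comes from a parity effect: for odd \<open>N\<close> any two lines of different directions meet in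
  exactly one point, whereas for even \<open>N\<close> a diagonal and a skew diagonal meet only if their
  indices have the same parity.

  For odd \<open>N\<close> this yields \<open>8 t(N) \<le> N\<^sup>2\<close>. Call a line black if it meets \<open>B\<close>, and let \<open>k(v)\<close> be
  the number of black lines among the four lines through \<open>v\<close>, so that \<open>k = 4\<close> on \<open>B\<close> and \<open>k = 0\<close>
  on \<open>W\<close>. Because the directions are pairwise independent, the first two moments of \<open>k\<close> depend
  only on the numbers of black lines in the four directions. Summing over the board a quadratic
  polynomial in \<open>k\<close> that is nonnegative at the integers therefore bounds a combination of \<open>|B|\<close>
  and \<open>|W|\<close>. The polynomials \<open>(k-1)(k-2)\<close> and \<open>(k-2)(k-3)\<close>, which weight \<open>B\<close> and \<open>W\<close> as
  \<open>3 : 1\<close> and \<open>1 : 3\<close>, suffice when between one sixth and five sixths of the lines are black, and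
  \<open>k(k-1)\<close> and \<open>(k-3)(k-4)\<close> settle the lopsided cases. This is \<open>four_net_separated_pair\<close>, applied to the torus
  in \<open>torus_t_odd_le\<close>.

  For even \<open>N = 2n\<close>, give the diagonals and skew diagonals of even index to \<open>B\<close>, and those of odd
  index to \<open>W\<close>. Only rows and columns then remain to be separated. Giving \<open>B\<close> the first \<open>k\<close> even
  rows and the first \<open>k\<close> even columns, and \<open>W\<close> all other rows and columns, yields \<open>|B| = k\<^sup>2\<close> and
  \<open>|W| = 2 n (n - k)\<close>. These balance at \<open>k = (\<surd>3 - 1) n\<close>, where both are \<open>(4 - 2 \<surd>3) n\<^sup>2\<close>, about
  \<open>0.5359 n\<^sup>2\<close>. Subtracting the bound \<open>(2n - 1)\<^sup>2 / 8 \<le> 0.5 n\<^sup>2\<close> for the odd torus leaves the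
  claimed gap.
\<close>

section \<open>Separated pairs in a 4-net\<close>

text \<open>
  Independence of two directions: each pair of labels is attained exactly once, so a double sum
  over labels factorises. This is the source of all moments below.
\<close>

lemma sum_of_bool_product:
  fixes f :: "'v \<Rightarrow> 'k" and g :: "'v \<Rightarrow> 'l"
  assumes bij: "bij_betw (\<lambda>v. (f v, g v)) V (K \<times> L)"
    and fin: "finite K" "finite L" and sub: "A \<subseteq> K" "C \<subseteq> L"
  shows "(\<Sum>v\<in>V. of_bool (f v \<in> A) * of_bool (g v \<in> C)) = real (card A) * real (card C)"
proof -
  have count: "(\<Sum>x\<in>X. of_bool (x \<in> Y)) = real (card Y)" if "finite X" "Y \<subseteq> X"
    for X Y :: "'z set"
    using that by (simp add: sum.If_cases of_bool_def inf.absorb2 Int_absorb1)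
  have "(\<Sum>v\<in>V. of_bool (f v \<in> A) * of_bool (g v \<in> C))
      = (\<Sum>p\<in>K \<times> L. of_bool (fst p \<in> A) * (of_bool (snd p \<in> C) :: real))"
    using sum.reindex_bij_betw
        [OF bij, of "\<lambda>p. of_bool (fst p \<in> A) * (of_bool (snd p \<in> C) :: real)"]
    by simp
  also have "\<dots> = (\<Sum>x\<in>K. of_bool (x \<in> A)) * (\<Sum>y\<in>L. of_bool (y \<in> C))"
    by (simp add: sum_product sum.cartesian_product case_prod_beta)
  also have "\<dots> = real (card A) * real (card C)"
    using sub fin by (simp add: count[of K A] Int_absorb1 Int_absorb2 of_bool_def sum.If_cases)
  finally show ?thesis .
qed

text \<open>
  The optimisation that is left once the moments are known: \<open>s\<close> is the total number of black
  lines, and the four inequalities come from the four polynomials. The graph of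
  \<open>3 s\<^sup>2 / 4 - 2 N s + 2 N\<^sup>2\<close> is at most \<open>N\<^sup>2\<close> exactly for \<open>2 N / 3 \<le> s \<le> 2 N\<close>, and \<open>s \<mapsto> 4 N - s\<close>
  exchanges the two colours.
\<close>

lemma moment_bounds_imp:
  fixes m s N :: real
  assumes N: "0 \<le> N" and s: "0 \<le> s" "s \<le> 4 * N"
    and near_B: "8 * m \<le> 3/4 * s\<^sup>2 - 2 * N * s + 2 * N\<^sup>2"
    and near_W: "8 * m \<le> 3/4 * s\<^sup>2 - 4 * N * s + 6 * N\<^sup>2"
    and far_B: "12 * m \<le> 3/4 * s\<^sup>2"
    and far_W: "12 * m \<le> 3/4 * (4 * N - s)\<^sup>2"
  shows "8 * m \<le> N\<^sup>2"
proof -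
  have main: "8 * m \<le> N\<^sup>2"
    if r: "0 \<le> r" "r \<le> 2 * N" and near: "8 * m \<le> 3/4 * r\<^sup>2 - 2 * N * r + 2 * N\<^sup>2"
      and far: "12 * m \<le> 3/4 * r\<^sup>2" for r
  proof (cases "2 * N \<le> 3 * r")
    case True
    then have "(3 * r - 2 * N) * (r - 2 * N) \<le> 0"
      using r by (intro mult_nonneg_nonpos) auto
    then show ?thesis
      using near by (simp add: algebra_simps power2_eq_square)
  next
    case False
    then have "(3 * r)\<^sup>2 \<le> (2 * N)\<^sup>2"
      using r by (intro power_mono) auto
    then have "9 * r\<^sup>2 \<le> 4 * N\<^sup>2"
      by (simp add: power_mult_distrib)
    moreover have "0 \<le> N\<^sup>2" by simp
    ultimately show ?thesis
      using far by linarith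
  qed
  show ?thesis
  proof (cases "s \<le> 2 * N")
    case True
    then show ?thesis using main[of s] s near_B far_B by blast
  next
    case False
    have "3/4 * s\<^sup>2 - 4 * N * s + 6 * N\<^sup>2 = 3/4 * (4*N - s)\<^sup>2 - 2 * N * (4*N - s) + 2 * N\<^sup>2"
      by (simp add: algebra_simps power2_eq_square)
    then show ?thesis
      using main[of "4 * N - s"] False s near_W far_W by auto
  qed
qed

text \<open>
  In direction \<open>i\<close>, the lines of the net are the fibres of \<open>line i\<close>, and \<open>k\<close> in the proof counts
  the black lines through a vertex. The second moment of \<open>k\<close> is the one place where the distribution of the black lines over the
  directions enters, and by Cauchy-Schwarz the balanced distribution is the worst one.
\<close>

lemma four_net_separated_pair:
  fixes line :: "nat \<Rightarrow> 'v \<Rightarrow> 'k"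
  assumes finK: "finite K" and cardK: "card K = N"
    and net: "\<And>i j. i < 4 \<Longrightarrow> j < 4 \<Longrightarrow> i \<noteq> j \<Longrightarrow>
                bij_betw (\<lambda>v. (line i v, line j v)) V (K \<times> K)"
    and sub: "B \<subseteq> V" "W \<subseteq> V"
    and sep: "\<And>i b w. i < 4 \<Longrightarrow> b \<in> B \<Longrightarrow> w \<in> W \<Longrightarrow> line i b \<noteq> line i w"
    and cards: "card B = m" "card W = m"
  shows "8 * m \<le> N\<^sup>2"
proof (cases "m = 0")
  case False
  define black where "black i = line i ` B" for i
  define a where "a i = real (card (black i))" for i
  define k where "k v = (\<Sum>i<4. of_bool (line i v \<in> black i) :: real)" for v
  define s where "s = (\<Sum>i<4. a i)"
  have finV: "finite V" and cardV: "card V = N\<^sup>2"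
    using bij_betw_finite[OF net[of 0 1]] bij_betw_same_card[OF net[of 0 1]] finK cardK
    by (simp_all add: card_cartesian_product power2_eq_square)
  have lineK: "line i v \<in> K" if "i < 4" "v \<in> V" for i v
  proof -
    have "(line i v, line (if i = 0 then 1 else 0) v) \<in> K \<times> K"
      using bij_betwE[OF net[of i "if i = 0 then 1 else 0"]] that by simp
    then show ?thesis by simp
  qed
  have black_sub: "black i \<subseteq> K" if "i < 4" for i
    using lineK[OF that] sub by (auto simp: black_def)
  have a_bounds: "0 \<le> a i" "i < 4 \<Longrightarrow> a i \<le> N" for i
    using card_mono[OF finK black_sub] by (auto simp: a_def cardK)

  have pair: "(\<Sum>v\<in>V. of_bool (line i v \<in> black i) * of_bool (line j v \<in> black j)) = a i * a j"
    if "i < 4" "j < 4" "i \<noteq> j" for i j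
    unfolding a_def
    by (rule sum_of_bool_product[OF net[OF that] finK finK black_sub black_sub]) (use that in auto)
  have single: "(\<Sum>v\<in>V. of_bool (line i v \<in> black i)) = a i * real N" if i: "i < 4" for i
  proof -
    obtain j :: nat where j: "j < 4" "i \<noteq> j"
      by (metis zero_less_numeral one_less_numeral_iff semiring_norm(76) zero_neq_one)
    have "(\<Sum>v\<in>V. of_bool (line i v \<in> black i))
        = (\<Sum>v\<in>V. of_bool (line i v \<in> black i) * (of_bool (line j v \<in> K) :: real))"
      using lineK[OF j(1)] by (intro sum.cong) auto
    also have "\<dots> = a i * real N"
      unfolding a_def cardK[symmetric]
      by (rule sum_of_bool_product[OF net[OF i j] finK finK black_sub[OF i] subset_refl])
    finally show ?thesis .
  qed

  have moment1: "(\<Sum>v\<in>V. k v) = N * s"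
  proof -
    have "(\<Sum>v\<in>V. k v) = (\<Sum>i<4. \<Sum>v\<in>V. of_bool (line i v \<in> black i))"
      unfolding k_def by (rule sum.swap)
    also have "\<dots> = (\<Sum>i<4. a i * N)"
      by (intro sum.cong) (auto simp: single)
    finally show ?thesis by (simp add: s_def sum_distrib_left mult.commute)
  qed
  have "(\<Sum>v\<in>V. (k v)\<^sup>2) = N * s + (s\<^sup>2 - (\<Sum>i<4. (a i)\<^sup>2))"
  proof -
    have "(\<Sum>v\<in>V. (k v)\<^sup>2) = (\<Sum>v\<in>V. \<Sum>i<4. \<Sum>j<4.
        of_bool (line i v \<in> black i) * of_bool (line j v \<in> black j))"
      unfolding k_def power2_eq_square sum_product ..
    also have "\<dots> = (\<Sum>i<4. \<Sum>v\<in>V. \<Sum>j<4.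
        of_bool (line i v \<in> black i) * of_bool (line j v \<in> black j))"
      by (rule sum.swap)
    also have "\<dots> = (\<Sum>i<4. \<Sum>j<4. \<Sum>v\<in>V.
        of_bool (line i v \<in> black i) * of_bool (line j v \<in> black j))"
      by (intro sum.cong refl sum.swap)
    also have "\<dots> = (\<Sum>i<4. \<Sum>j<4. a i * a j + (if i = j then a i * N - (a i)\<^sup>2 else 0))"
    proof (intro sum.cong refl)
      fix i j :: nat assume "i \<in> {..<4}" "j \<in> {..<4}"
      then show "(\<Sum>v\<in>V. of_bool (line i v \<in> black i) * of_bool (line j v \<in> black j))
          = a i * a j + (if i = j then a i * N - (a i)\<^sup>2 else 0)"
        using pair[of i j] single[of i]
        by (cases "i = j") (simp_all add: power2_eq_square flip: of_bool_conj)
    qed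
    also have "\<dots> = s\<^sup>2 + (\<Sum>i<4. a i * N - (a i)\<^sup>2)"
      by (simp add: sum.distrib s_def power2_eq_square sum_product)
    finally show ?thesis
      by (simp add: s_def sum_subtractf sum_distrib_left mult.commute)
  qed
  moreover have "s\<^sup>2 \<le> 4 * (\<Sum>i<4. (a i)\<^sup>2)"
    using sum_squared_le_sum_of_squares[of a "{..<4}"] by (simp add: s_def)
  ultimately have moment2: "(\<Sum>v\<in>V. (k v)\<^sup>2) \<le> N * s + 3/4 * s\<^sup>2"
    by simp

  have k_int: "\<exists>z::int. k v = z" for v
    by (rule exI[of _ "\<Sum>i<4. of_bool (line i v \<in> black i)"]) (simp add: k_def)
  have k_B: "k b = 4" if "b \<in> B" for b
    using that by (simp add: k_def black_def)
  have k_W: "k w = 0" if "w \<in> W" for w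
    using sep[OF _ _ that] by (fastforce simp: k_def black_def intro!: sum.neutral)
  have disj: "B \<inter> W = {}"
    using k_B k_W by fastforce

  \<comment> \<open>Two consecutive integer roots keep the quadratic nonnegative at every integer.\<close>
  have weight: "(4 - c) * (3 - c) * m + c * (c + 1) * m
      \<le> N * s + 3/4 * s\<^sup>2 - (2 * c + 1) * (N * s) + c * (c + 1) * N\<^sup>2" for c :: int
  proof -
    define P where "P x = (x - c) * (x - (c + 1))" for x :: real
    have P_k: "0 \<le> P (k v)" for v
    proof -
      obtain z :: int where z: "k v = z" using k_int by blast
      have "0 \<le> (z - c) * (z - (c + 1))"
        by (cases "z \<le> c") (auto intro: mult_nonpos_nonpos)
      then have "0 \<le> real_of_int ((z - c) * (z - (c + 1)))"
        by (simp only: of_int_0_le_iff)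
      then show ?thesis by (simp add: P_def z)
    qed
    have "(4 - c) * (3 - c) * m + c * (c + 1) * m = (\<Sum>v\<in>B. P (k v)) + (\<Sum>v\<in>W. P (k v))"
      by (simp add: k_B k_W P_def cards algebra_simps)
    also have "\<dots> = (\<Sum>v\<in>B \<union> W. P (k v))"
      using disj finite_subset[OF _ finV] sub by (intro sum.union_disjoint[symmetric]) auto
    also have "\<dots> \<le> (\<Sum>v\<in>V. P (k v))"
      using P_k finV sub by (intro sum_mono2) auto
    also have "\<dots> = (\<Sum>v\<in>V. (k v)\<^sup>2 - (2 * c + 1) * k v + c * (c + 1))"
      by (intro sum.cong) (auto simp: P_def algebra_simps power2_eq_square)
    also have "\<dots> = (\<Sum>v\<in>V. (k v)\<^sup>2) - (2 * c + 1) * (N * s) + c * (c + 1) * N\<^sup>2"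
      by (simp add: sum.distrib sum_subtractf cardV moment1 flip: sum_distrib_left)
    finally show ?thesis using moment2 by simp
  qed

  have "8 * real m \<le> (real N)\<^sup>2"
  proof (rule moment_bounds_imp[where s = s])
    show "0 \<le> s" unfolding s_def by (intro sum_nonneg) (use a_bounds in auto)
    show "s \<le> 4 * real N"
      unfolding s_def using sum_bounded_above[of "{..<4}" a "real N"] a_bounds by simp
    show "8 * real m \<le> 3/4 * s\<^sup>2 - 2 * real N * s + 2 * (real N)\<^sup>2"
      using weight[of 1] by (simp add: mult.commute)
    show "8 * real m \<le> 3/4 * s\<^sup>2 - 4 * real N * s + 6 * (real N)\<^sup>2"
      using weight[of 2] by (simp add: mult.commute)
    show "12 * real m \<le> 3/4 * s\<^sup>2"
      using weight[of 0] by simp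
    show "12 * real m \<le> 3/4 * (4 * real N - s)\<^sup>2"
      using weight[of 3] by (simp add: power2_eq_square algebra_simps)
  qed simp
  then have "real (8 * m) \<le> real (N\<^sup>2)" by simp
  then show ?thesis by (simp only: of_nat_le_iff)
qed simp

section \<open>The odd torus\<close>

text \<open>
  The four directions are the linear forms \<open>x\<close>, \<open>y\<close>, \<open>x + y\<close> and \<open>x - y\<close>. Any two of them have
  determinant \<open>1\<close>, \<open>-1\<close>, \<open>2\<close> or \<open>-2\<close>, which is a unit modulo an odd number.
\<close>

definition form_x :: "nat \<Rightarrow> int" where
  "form_x i = [1, 0, 1, 1] ! i"

definition form_y :: "nat \<Rightarrow> int" where
  "form_y i = [0, 1, 1, -1] ! i"

definition torus_line :: "nat \<Rightarrow> nat \<Rightarrow> nat \<times> nat \<Rightarrow> int" where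
  "torus_line N i v = (form_x i * int (fst v) + form_y i * int (snd v)) mod int N"

lemma less_4_cases: "(i::nat) < 4 \<Longrightarrow> i = 0 \<or> i = 1 \<or> i = 2 \<or> i = 3"
  by auto

lemma coprime_form_determinant:
  assumes "odd N" "i < 4" "j < 4" "i \<noteq> j"
  shows "coprime (int N) (form_x i * form_y j - form_x j * form_y i)"
proof -
  have "coprime (int N) 2" using assms(1) by (simp add: coprime_commute)
  then show ?thesis
    using less_4_cases[OF assms(2)] less_4_cases[OF assms(3)] assms(4)
    by (auto simp: form_x_def form_y_def)
qed

lemma cong_board_coordinate:
  assumes "[int x = int x'] (mod int N)" "x \<in> {1..N}" "x' \<in> {1..N}"
  shows "x = x'"
proof -
  have "[x - 1 = x' - 1] (mod N)"
    using assms cong_diff[OF assms(1) cong_refl[of 1 "int N"]]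
    by (simp add: cong_int_iff[symmetric] of_nat_diff)
  then have "x - 1 = x' - 1"
    by (rule cong_less_modulus_unique_nat) (use assms in auto)
  then show ?thesis using assms by auto
qed

lemma torus_line_eq_iff:
  "torus_line N i v = torus_line N i w \<longleftrightarrow>
     int N dvd form_x i * (int (fst v) - int (fst w)) + form_y i * (int (snd v) - int (snd w))"
  by (simp add: torus_line_def mod_eq_dvd_iff algebra_simps)

lemma torus_lines_bij:
  assumes N: "odd N" and ij: "i < 4" "j < 4" "i \<noteq> j"
  shows "bij_betw (\<lambda>v. (torus_line N i v, torus_line N j v)) (torus_vertices N)
           ({0..<int N} \<times> {0..<int N})"
proof -
  let ?L = "\<lambda>v. (torus_line N i v, torus_line N j v)"
  let ?K = "{0..<int N} \<times> {0..<int N}"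
  have "inj_on ?L (torus_vertices N)"
  proof (rule inj_onI)
    fix v w assume vw: "v \<in> torus_vertices N" "w \<in> torus_vertices N" and "?L v = ?L w"
    define d where "d = int (fst v) - int (fst w)"
    define e where "e = int (snd v) - int (snd w)"
    define D where "D = form_x i * form_y j - form_x j * form_y i"
    have i: "int N dvd form_x i * d + form_y i * e"
      and j: "int N dvd form_x j * d + form_y j * e"
      using \<open>?L v = ?L w\<close> by (simp_all add: torus_line_eq_iff d_def e_def)
    \<comment> \<open>Eliminating either unknown, as in Cramer's rule, leaves the other times the determinant.\<close>
    have "int N dvd form_y j * (form_x i * d + form_y i * e) - form_y i * (form_x j * d + form_y j * e)"
      and "int N dvd form_x i * (form_x j * d + form_y j * e) - form_x j * (form_x i * d + form_y i * e)"
      using i j by (simp_all only: dvd_diff dvd_mult)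
    then have "int N dvd D * d" "int N dvd D * e"
      by (simp_all add: D_def algebra_simps)
    then have "int N dvd d" "int N dvd e"
      using coprime_form_determinant[OF N ij]
      by (simp_all add: D_def coprime_dvd_mult_right_iff)
    then have "[int (fst v) = int (fst w)] (mod int N)" "[int (snd v) = int (snd w)] (mod int N)"
      by (simp_all add: cong_iff_dvd_diff d_def e_def)
    then show "v = w"
      using cong_board_coordinate vw by (auto simp: torus_vertices_def prod_eq_iff mem_Times_iff)
  qed
  moreover have "?L ` torus_vertices N = ?K"
  proof (rule card_subset_eq)
    show "?L ` torus_vertices N \<subseteq> ?K"
      using odd_pos[OF N] by (auto simp: torus_line_def)
    show "card (?L ` torus_vertices N) = card ?K"
      using calculation
      by (simp add: card_image torus_vertices_def card_cartesian_product)
  qed simp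
  ultimately show ?thesis by (simp add: bij_betw_def)
qed

lemma peaceful_battle_torus_line_neq:
  assumes battle: "peaceful_battle N B W" and i: "i < 4" and b: "b \<in> B" and w: "w \<in> W"
  shows "torus_line N i b \<noteq> torus_line N i w"
proof
  assume eq: "torus_line N i b = torus_line N i w"
  obtain x y where bxy: "b = (x, y)" by (cases b)
  obtain x' y' where wxy: "w = (x', y')" by (cases w)
  have in_V: "x \<in> {1..N}" "y \<in> {1..N}" "x' \<in> {1..N}" "y' \<in> {1..N}"
    using battle b w by (auto simp: peaceful_battle_def torus_vertices_def bxy wxy)
  then have N: "0 < int N" by simp
  have no_edge: False if "e \<in> torus_hyperedges N" "b \<in> e" "w \<in> e" for e
    using battle that b w unfolding peaceful_battle_def by blast
  consider "i = 0" | "i = 1" | "i = 2" | "i = 3" using less_4_cases[OF i] by blast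
  then show False
  proof cases
    case 1
    then have "[int x = int x'] (mod int N)"
      using eq by (simp add: torus_line_def form_x_def form_y_def cong_def bxy wxy)
    then have "x = x'" using in_V by (intro cong_board_coordinate)
    then show False
      using in_V by (intro no_edge[of "torus_row N x"])
        (auto simp: torus_hyperedges_def torus_row_def bxy wxy)
  next
    case 2
    then have "[int y = int y'] (mod int N)"
      using eq by (simp add: torus_line_def form_x_def form_y_def cong_def bxy wxy)
    then have "y = y'" using in_V by (intro cong_board_coordinate)
    then show False
      using in_V by (intro no_edge[of "torus_column N y"])
        (auto simp: torus_hyperedges_def torus_column_def bxy wxy)
  next
    case 3
    then have cong: "(int x + int y) mod int N = (int x' + int y') mod int N"
      using eq by (simp add: torus_line_def form_x_def form_y_def bxy wxy)
    let ?e = "torus_skew_diagonal N ((int x + int y) mod int N)"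
    have "?e \<in> torus_hyperedges N"
      using N by (auto simp: torus_hyperedges_def)
    then show False
      using no_edge[of ?e] in_V cong
      by (auto simp: torus_skew_diagonal_def torus_vertices_def cong_def bxy wxy)
  next
    case 4
    then have cong: "(int x - int y) mod int N = (int x' - int y') mod int N"
      using eq by (simp add: torus_line_def form_x_def form_y_def bxy wxy)
    let ?e = "torus_diagonal N ((int x - int y) mod int N)"
    have "?e \<in> torus_hyperedges N"
      using N by (auto simp: torus_hyperedges_def)
    then show False
      using no_edge[of ?e] in_V cong
      by (auto simp: torus_diagonal_def torus_vertices_def cong_def bxy wxy)
  qed
qed

theorem torus_t_odd_le:
  assumes "odd N"
  shows "8 * torus_t N \<le> N\<^sup>2"
proof -
  have "torus_t N \<in> battle_sizes N"
    unfolding torus_t_def using finite_battle_sizes zero_in_battle_sizes by (intro Max_in) auto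
  then obtain B W where battle: "peaceful_battle N B W"
    and cards: "card B = torus_t N" "card W = torus_t N"
    by (auto simp: battle_sizes_def)
  show ?thesis
  proof (rule four_net_separated_pair[where line = "torus_line N" and K = "{0..<int N}"])
    show "B \<subseteq> torus_vertices N" "W \<subseteq> torus_vertices N"
      using battle by (auto simp: peaceful_battle_def)
    show "bij_betw (\<lambda>v. (torus_line N i v, torus_line N j v)) (torus_vertices N)
        ({0..<int N} \<times> {0..<int N})" if "i < 4" "j < 4" "i \<noteq> j" for i j
      by (rule torus_lines_bij[OF assms that])
    show "torus_line N i b \<noteq> torus_line N i w" if "i < 4" "b \<in> B" "w \<in> W" for i b w
      by (rule peaceful_battle_torus_line_neq[OF battle that])
  qed (simp_all add: cards)
qed

section \<open>The even torus\<close>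

lemma torus_t_ge_min_card:
  assumes battle: "peaceful_battle N B W"
  shows "min (card B) (card W) \<le> torus_t N"
proof -
  let ?m = "min (card B) (card W)"
  obtain B' where B': "B' \<subseteq> B" "card B' = ?m"
    by (rule obtain_subset_with_card_n[of ?m B]) simp
  obtain W' where W': "W' \<subseteq> W" "card W' = ?m"
    by (rule obtain_subset_with_card_n[of ?m W]) simp
  have "peaceful_battle N B' W'"
    unfolding peaceful_battle_def
  proof (intro conjI ballI)
    show "B' \<subseteq> torus_vertices N" "W' \<subseteq> torus_vertices N" "B' \<inter> W' = {}"
      using battle B'(1) W'(1) by (auto simp: peaceful_battle_def)
    fix e assume "e \<in> torus_hyperedges N"
    then have "e \<inter> B = {} \<or> e \<inter> W = {}"
      using battle by (simp add: peaceful_battle_def)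
    then show "e \<inter> B' = {} \<or> e \<inter> W' = {}"
      using B'(1) W'(1) by auto
  qed
  then have "?m \<in> battle_sizes N"
    unfolding battle_sizes_def mem_Collect_eq using B'(2) W'(2) by (intro exI conjI)
  then show ?thesis
    unfolding torus_t_def by (rule Max_ge[OF finite_battle_sizes])
qed

text \<open>
  An even modulus allows reduction modulo \<open>2\<close>, where difference and sum of the coordinates agree.
  Hence neither kind of diagonal can meet both colour classes of the checkerboard.
\<close>

lemma even_torus_diagonal_parity:
  assumes "v \<in> torus_diagonal (2 * n) k \<union> torus_skew_diagonal (2 * n) k"
  shows "even (fst v + snd v) \<longleftrightarrow> even k"
proof -
  obtain i j where v: "v = (i, j)" by (cases v)
  have "[int i - int j = k] (mod int (2 * n)) \<or> [int i + int j = k] (mod int (2 * n))"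
    using assms by (auto simp: torus_diagonal_def torus_skew_diagonal_def v)
  moreover have "2 dvd int (2 * n)" by simp
  ultimately have "[int i - int j = k] (mod 2) \<or> [int i + int j = k] (mod 2)"
    using cong_dvd_modulus by blast
  then have "even (int i + int j) \<longleftrightarrow> even k"
    by (auto simp: cong_iff_dvd_diff)
  then show ?thesis by (simp add: v)
qed

text \<open>
  The sets \<open>B\<close> and \<open>W\<close> in the proof lie in opposite classes of the checkerboard, which takes care of
  both kinds of diagonals. Both coordinates of a vertex in \<open>B\<close> are among the first \<open>k\<close> even numbers;
  a vertex in \<open>W\<close> has one odd coordinate, and its even coordinate comes after these, which takes
  care of the rows and columns.
\<close>

lemma torus_t_even_ge:
  assumes "k \<le> n"
  shows "min (k\<^sup>2) (2 * n * (n - k)) \<le> torus_t (2 * n)"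
proof -
  define near where "near = (\<lambda>i. 2 * i) ` {1..k}"
  define far where "far = (\<lambda>i. 2 * i) ` {k<..n}"
  define odds where "odds = (\<lambda>i. 2 * i - 1) ` {1..n}"
  define B where "B = near \<times> near"
  define W where "W = odds \<times> far \<union> far \<times> odds"
  have fin: "finite odds" "finite far" by (simp_all add: odds_def far_def)
  have sizes: "card near = k" "card far = n - k" "card odds = n"
    unfolding near_def far_def odds_def by (subst card_image; force simp: inj_on_def)+
  have near_even: "even i" if "i \<in> near" for i using that by (auto simp: near_def)
  have far_even: "even i" if "i \<in> far" for i using that by (auto simp: far_def)
  have odds_odd: "odd i" if "i \<in> odds" for i using that by (auto simp: odds_def)
  have near_far: "near \<inter> far = {}" by (auto simp: near_def far_def)
  have near_odds: "near \<inter> odds = {}" using near_even odds_odd by blast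
  have far_odds: "far \<inter> odds = {}" using far_even odds_odd by blast
  have card_B: "card B = k\<^sup>2"
    by (simp add: B_def card_cartesian_product sizes power2_eq_square)
  have "card W = card (odds \<times> far) + card (far \<times> odds)"
    unfolding W_def using fin far_odds by (intro card_Un_disjoint) auto
  then have card_W: "card W = 2 * n * (n - k)"
    by (simp add: card_cartesian_product sizes)
  have even_B: "even (fst v + snd v)" if "v \<in> B" for v
    using that near_even by (auto simp: B_def)
  have odd_W: "odd (fst v + snd v)" if "v \<in> W" for v
    using that far_even odds_odd by (auto simp: W_def)

  have "peaceful_battle (2 * n) B W"
    unfolding peaceful_battle_def
  proof (intro conjI ballI)
    show "B \<subseteq> torus_vertices (2 * n)" "W \<subseteq> torus_vertices (2 * n)"
      using assms by (auto simp: B_def W_def near_def far_def odds_def torus_vertices_def)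
    show "B \<inter> W = {}" using even_B odd_W by blast
    fix e assume "e \<in> torus_hyperedges (2 * n)"
    then consider i where "e = torus_row (2 * n) i" | j where "e = torus_column (2 * n) j"
      | l where "e = torus_diagonal (2 * n) l" | l where "e = torus_skew_diagonal (2 * n) l"
      by (auto simp: torus_hyperedges_def)
    then show "e \<inter> B = {} \<or> e \<inter> W = {}"
    proof cases
      case 1
      then show ?thesis
        using near_far near_odds by (auto simp: torus_row_def B_def W_def)
    next
      case 2
      then show ?thesis
        using near_far near_odds by (auto simp: torus_column_def B_def W_def)
    next
      case (3 l)
      then show ?thesis
        using even_B odd_W even_torus_diagonal_parity[of _ n l] by blast
    next
      case (4 l)
      then show ?thesis
        using even_B odd_W even_torus_diagonal_parity[of _ n l] by blast
    qed
  qed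
  from torus_t_ge_min_card[OF this] show ?thesis
    by (simp add: card_B card_W)
qed

section \<open>The gap\<close>

theorem corollary1p6:
  shows "\<forall>\<^sub>F n :: nat in sequentially.
           real (torus_t (2 * n)) - real (torus_t (2 * n - 1)) \<ge> 0.0356 * (real n)\<^sup>2"
  using eventually_ge_at_top[of "5000::nat"]
proof eventually_elim
  case (elim n)
  \<comment> \<open>\<open>183/250 = 0.732\<close> approximates the balanced ratio \<open>\<surd>3 - 1\<close>, and \<open>n \<ge> 5000\<close> absorbs the rounding.
     The value \<open>1339/2500 = 0.5356\<close> exceeds the \<open>1/2\<close> of the odd torus by the claimed gap.\<close>
  define k where "k = nat \<lceil>183/250 * real n\<rceil>"
  have k: "183/250 * real n \<le> k" "k \<le> 183/250 * real n + 1"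
  proof -
    have "real k = real_of_int \<lceil>183/250 * real n\<rceil>"
      unfolding k_def by (intro of_nat_nat) simp
    then show "183/250 * real n \<le> k" "k \<le> 183/250 * real n + 1"
      using ceiling_correct[of "183/250 * real n"] by linarith+
  qed
  have n: "5000 \<le> real n" using elim by simp
  have "real k \<le> real n" using k n by linarith
  then have kn: "k \<le> n" by simp

  have "1339/2500 * (real n)\<^sup>2 \<le> (183/250 * real n)\<^sup>2"
    unfolding power_mult_distrib by (intro mult_right_mono) (simp_all add: power2_eq_square)
  also have "\<dots> \<le> (real k)\<^sup>2"
    using k by (intro power_mono) auto
  finally have black: "1339/2500 * (real n)\<^sup>2 \<le> real (k\<^sup>2)"
    by (simp only: of_nat_power)
  have "1339/5000 * real n \<le> real (n - k)"
    unfolding of_nat_diff[OF kn] using k n by linarith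
  then have "2 * real n * (1339/5000 * real n) \<le> 2 * real n * real (n - k)"
    by (intro mult_left_mono) auto
  then have white: "1339/2500 * (real n)\<^sup>2 \<le> real (2 * n * (n - k))"
    by (simp add: power2_eq_square)
  have "1339/2500 * (real n)\<^sup>2 \<le> real (min (k\<^sup>2) (2 * n * (n - k)))"
    unfolding of_nat_min using black white by (rule min.boundedI)
  also have "\<dots> \<le> real (torus_t (2 * n))"
    using torus_t_even_ge[OF kn] by (simp only: of_nat_le_iff)
  finally have even_side: "1339/2500 * (real n)\<^sup>2 \<le> real (torus_t (2 * n))" .

  have "8 * torus_t (2 * n - 1) \<le> (2 * n - 1)\<^sup>2"
    using elim by (intro torus_t_odd_le) simp
  also have "\<dots> \<le> (2 * n)\<^sup>2"
    by (intro power_mono) auto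
  finally have "real (8 * torus_t (2 * n - 1)) \<le> real ((2 * n)\<^sup>2)"
    by (simp only: of_nat_le_iff)
  then have odd_side: "real (torus_t (2 * n - 1)) \<le> 1/2 * (real n)\<^sup>2"
    by (simp add: power_mult_distrib)

  show ?case using even_side odd_side by simp
qed

end
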